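(* Let $\mathcal B=(\mathbf x_n)_{n=1}^\infty$ be a semi-normalized Markushevich basis of a Banach space $\mathbb X$ over $\mathbb F=\mathbb R$ or $\mathbb C$. The following are equivalent: (a) $\mathcal B$ is $1$-greedy. (b) For every $f\in\mathbb X$, $\Vert f-\mathcal G_1(f)\Vert=\sigma_1(f)$. (c) $\mathcal B$ is $1$-symmetric for largest coefficients and $1$-suppression unconditional. (d) $\mathcal B$ has the Property (Q$^*$) with constant $\mathcal Q=1$.
   Context: Setting. $\mathbb X$ is a Banach space over $\mathbb F=\mathbb R$ or $\mathbb C$. A sequence $\mathcal B=(\mathbf x_n)_{n=1}^\infty\subset\mathbb X$ is a semi-normalized Markushevich basis if: the closed linear span of $(\mathbf x_n)_n$ is $\mathbb X$; there is a unique sequence $(\mathbf x_n^* )_{n=1}^\infty\subset\mathbb X^*$ with $\mathbf x_n^*(\mathbf x_j)=\delta_{n,j}$; the weak$^*$-closed linear span of $(\mathbf x_n^* )_n$ is $\mathbb X^*$; and there are constants $c_1,c_2$ with $0<c_1\le \inf_n\{\Vert \mathbf x_n\Vert,\Vert\mathbf x_n^*\Vert\}\le\sup_n\{\Vert \mathbf x_n\Vert,\Vert\mathbf x_n^*\Vert\}\le c_2<\infty$. Notation. $\operatorname{supp}(f)=\{n\in\mathbb N:\mathbf x_n^*(f)\neq0\}$; $\mathbb X_f$ denotes the subspace of all elements of $\mathbb X$ with finite support; $\Vert(\mathbf x_n^*(f))_n\Vert_\infty=\sup_{n\in\operatorname{supp}(f)}\vert\mathbf x_n^*(f)\vert$ (equal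 to $0$ if $f=0$). For a finite set $A\subset\mathbb N$, $P_A(f)=\sum_{j\in A}\mathbf x_j^*(f)\mathbf x_j$. For a finite set $A$ and scalars $\varepsilon=(\varepsilon_n)_{n\in A}$ with $\vert\varepsilon_n\vert=1$ for all $n\in A$ (written $\vert\varepsilon\vert=1$), $\mathbf 1_{\varepsilon A}=\sum_{j\in A}\varepsilon_j\mathbf x_j$. Greedy sums. For $f\in\mathbb X$, the natural greedy ordering of $f$ is a map $\rho:\mathbb N\to\mathbb N$ with $\operatorname{supp}(f)\subseteq\rho(\mathbb N)$ such that if $j<k$ then either $\vert\mathbf x_{\rho(j)}^*(f)\vert>\vert\mathbf x_{\rho(k)}^*(f)\vert$, or $\vert\mathbf x_{\rho(j)}^*(f)\vert=\vert\mathbf x_{\rho(k)}^*(f)\vert$ and $\rho(j)<\rho(k)$. The $m$th greedy sum is $\mathcal G_m(f)=\sum_{j=1}^m\mathbf x_{\rho(j)}^*(f)\mathbf x_{\rho(j)}$. The best $m$th error is $\sigma_m(f)=\inf\{\Vert f-\sum_{j\in B}a_j\mathbf x_j\Vert: B\subset\mathbb N,\ \vert B\vert\le m,\ a_j\in\mathbb F\}$. Definitions. - $\mathcal B$ is $1$-greedy if $\Vert f-\mathcal G_m(f)\Vert\le\sigma_m(f)$ for all $m\in\mathbb N$ and all $f\in\mathbb X$. - $\mathcal B$ is $1$-suppression unconditional if $\Vert f-P_A(f)\Vert\le\Vert f\Vert$ for all finite $A\subset\mathbb N$ and all $f\in\mathbb X$. - $\mathcal B$ is $1$-symmetric for largest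 coefficients if $\Vert f+\mathbf 1_{\varepsilon A}\Vert\le\Vert f+\mathbf 1_{\eta B}\Vert$ for all $f\in\mathbb X$, $A,B,\varepsilon,\eta$ such that $\Vert(\mathbf x_n^*(f))_n\Vert_\infty\le1$, $\vert A\vert\le\vert B\vert<\infty$, $A\cap B=\emptyset$, $\operatorname{supp}(f)\cap(A\cup B)=\emptyset$ and $\vert\varepsilon\vert=\vert\eta\vert=1$. - $\mathcal B$ has the Property (Q$^*$) with constant $\mathcal Q=1$ if $\Vert f+\mathbf 1_{\varepsilon A}\Vert\le\Vert f+y\Vert$ for all $f\in\mathbb X$, $y\in\mathbb X_f$, $A$ and $\varepsilon$ such that $\Vert(\mathbf x_n^*(f))_n\Vert_\infty\le1$, $\vert A\vert\le\vert B\vert<\infty$ where $B=\{n\in\operatorname{supp}(y):\vert\mathbf x_n^*(y)\vert=1\}$, $\operatorname{supp}(f)\cap\operatorname{supp}(y)=\emptyset$, $\operatorname{supp}(f+y)\cap A=\emptyset$ and $\vert\varepsilon\vert=1$. *)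

theory Defs
  imports "HOL-Analysis.Analysis"
begin

text \<open>
  The scalar field \<open>\<F>\<close> is a type \<open>'f\<close> of class \<^class>\<open>real_normed_field\<close>. By the Gelfand-Mazur
  theorem, \<open>\<real>\<close> and \<open>\<complex>\<close> are, up to isometric isomorphism, the only instances of this class (recall
  that \<open>norm (a * b) = norm a * norm b\<close> is one of its axioms). The locale equips a type of class
  \<^class>\<open>banach\<close> with a scalar multiplication by \<open>\<F>\<close> that extends the real one.
\<close>

locale banach_space_over = vector_space smul
  for smul :: "'f::real_normed_field \<Rightarrow> 'a::banach \<Rightarrow> 'a" +
  assumes scale_of_real: "smul (of_real r) v = r *\<^sub>R v"
    and norm_scale: "norm (smul c v) = norm c * norm v"

text \<open>Elements of \<open>'a \<Rightarrow>\<^sub>L 'f\<close> are only real-linear, so \<open>\<F>\<close>-homogeneity is imposed separately.\<close>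

definition dual_space ::
    "('f::real_normed_field \<Rightarrow> 'a::banach \<Rightarrow> 'a) \<Rightarrow> ('a \<Rightarrow>\<^sub>L 'f) set" where
  "dual_space smul = {\<phi>. \<forall>c v. blinfun_apply \<phi> (smul c v) = c * blinfun_apply \<phi> v}"

definition dual_scale ::
    "'f::real_normed_field \<Rightarrow> ('a::banach \<Rightarrow>\<^sub>L 'f) \<Rightarrow> ('a \<Rightarrow>\<^sub>L 'f)" where
  "dual_scale c \<phi> = blinfun_mult_right c o\<^sub>L \<phi>"

definition biorthogonal ::
    "('f::real_normed_field \<Rightarrow> 'a::banach \<Rightarrow> 'a) \<Rightarrow> (nat \<Rightarrow> 'a) \<Rightarrow> (nat \<Rightarrow> 'a \<Rightarrow>\<^sub>L 'f) \<Rightarrow> bool" where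
  "biorthogonal smul x xs \<longleftrightarrow>
     range xs \<subseteq> dual_space smul \<and>
     (\<forall>n j. blinfun_apply (xs n) (x j) = (if n = j then 1 else 0))"

text \<open>
  The basis is indexed by \<open>0, 1, 2, \<dots>\<close> instead of \<open>1, 2, 3, \<dots>\<close>. The sequence \<open>xs\<close> consists of the
  coordinate functionals. On maps into the scalar field, the strong operator topology is the
  topology of pointwise convergence, so on the dual space it is the weak* topology; the dual space
  is closed in \<open>'a \<Rightarrow>\<^sub>L 'f\<close>, hence closures may be taken in either.
\<close>

definition semi_normalized_M_basis ::
    "('f::real_normed_field \<Rightarrow> 'a::banach \<Rightarrow> 'a) \<Rightarrow> (nat \<Rightarrow> 'a) \<Rightarrow> (nat \<Rightarrow> 'a \<Rightarrow>\<^sub>L 'f) \<Rightarrow> bool" where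
  "semi_normalized_M_basis smul x xs \<longleftrightarrow>
     closure (module.span smul (range x)) = UNIV \<and>
     biorthogonal smul x xs \<and> (\<forall>ys. biorthogonal smul x ys \<longrightarrow> ys = xs) \<and>
     strong_operator_topology closure_of (module.span dual_scale (range xs)) = dual_space smul \<and>
     (\<exists>c1 c2. 0 < c1 \<and>
        (\<forall>n. c1 \<le> norm (x n) \<and> norm (x n) \<le> c2 \<and> c1 \<le> norm (xs n) \<and> norm (xs n) \<le> c2))"

definition supp :: "(nat \<Rightarrow> 'a::banach \<Rightarrow>\<^sub>L 'f::real_normed_field) \<Rightarrow> 'a \<Rightarrow> nat set" where
  "supp xs f = {n. blinfun_apply (xs n) f \<noteq> 0}"

definition finite_support :: "(nat \<Rightarrow> 'a::banach \<Rightarrow>\<^sub>L 'f::real_normed_field) \<Rightarrow> 'a set" where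
  "finite_support xs = {f. finite (supp xs f)}"

definition coeff_sup_norm :: "(nat \<Rightarrow> 'a::banach \<Rightarrow>\<^sub>L 'f::real_normed_field) \<Rightarrow> 'a \<Rightarrow> real" where
  "coeff_sup_norm xs f = (if f = 0 then 0 else (SUP n\<in>supp xs f. norm (blinfun_apply (xs n) f)))"

definition proj ::
    "('f::real_normed_field \<Rightarrow> 'a::banach \<Rightarrow> 'a) \<Rightarrow> (nat \<Rightarrow> 'a) \<Rightarrow> (nat \<Rightarrow> 'a \<Rightarrow>\<^sub>L 'f) \<Rightarrow>
     nat set \<Rightarrow> 'a \<Rightarrow> 'a" where
  "proj smul x xs A f = (\<Sum>j\<in>A. smul (blinfun_apply (xs j) f) (x j))"

definition signed_indicator ::
    "('f::real_normed_field \<Rightarrow> 'a::banach \<Rightarrow> 'a) \<Rightarrow> (nat \<Rightarrow> 'a) \<Rightarrow> (nat \<Rightarrow> 'f) \<Rightarrow> nat set \<Rightarrow> 'a" where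
  "signed_indicator smul x \<epsilon> A = (\<Sum>j\<in>A. smul (\<epsilon> j) (x j))"

definition is_greedy_ordering ::
    "(nat \<Rightarrow> 'a::banach \<Rightarrow>\<^sub>L 'f::real_normed_field) \<Rightarrow> 'a \<Rightarrow> (nat \<Rightarrow> nat) \<Rightarrow> bool" where
  "is_greedy_ordering xs f \<rho> \<longleftrightarrow>
     supp xs f \<subseteq> range \<rho> \<and>
     (\<forall>j k. j < k \<longrightarrow>
        norm (blinfun_apply (xs (\<rho> j)) f) > norm (blinfun_apply (xs (\<rho> k)) f) \<or>
        (norm (blinfun_apply (xs (\<rho> j)) f) = norm (blinfun_apply (xs (\<rho> k)) f) \<and> \<rho> j < \<rho> k))"

text \<open>
  Two greedy orderings of \<open>f\<close> can differ only at positions beyond the size of a finite support, where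
  the coefficients vanish; so the choice made by \<open>SOME\<close> does not affect the greedy sums.
\<close>

definition greedy_sum ::
    "('f::real_normed_field \<Rightarrow> 'a::banach \<Rightarrow> 'a) \<Rightarrow> (nat \<Rightarrow> 'a) \<Rightarrow> (nat \<Rightarrow> 'a \<Rightarrow>\<^sub>L 'f) \<Rightarrow>
     nat \<Rightarrow> 'a \<Rightarrow> 'a" where
  "greedy_sum smul x xs m f =
     (let \<rho> = (SOME \<rho>. is_greedy_ordering xs f \<rho>)
      in \<Sum>j<m. smul (blinfun_apply (xs (\<rho> j)) f) (x (\<rho> j)))"

definition best_error ::
    "('f::real_normed_field \<Rightarrow> 'a::banach \<Rightarrow> 'a) \<Rightarrow> (nat \<Rightarrow> 'a) \<Rightarrow> nat \<Rightarrow> 'a \<Rightarrow> real" where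
  "best_error smul x m f =
     Inf {norm (f - (\<Sum>j\<in>B. smul (a j) (x j))) | (B :: nat set) (a :: nat \<Rightarrow> 'f).
            finite B \<and> card B \<le> m}"

definition one_greedy ::
    "('f::real_normed_field \<Rightarrow> 'a::banach \<Rightarrow> 'a) \<Rightarrow> (nat \<Rightarrow> 'a) \<Rightarrow> (nat \<Rightarrow> 'a \<Rightarrow>\<^sub>L 'f) \<Rightarrow> bool" where
  "one_greedy smul x xs \<longleftrightarrow>
     (\<forall>m\<ge>1. \<forall>f. norm (f - greedy_sum smul x xs m f) \<le> best_error smul x m f)"

definition one_suppression_unconditional ::
    "('f::real_normed_field \<Rightarrow> 'a::banach \<Rightarrow> 'a) \<Rightarrow> (nat \<Rightarrow> 'a) \<Rightarrow> (nat \<Rightarrow> 'a \<Rightarrow>\<^sub>L 'f) \<Rightarrow> bool" where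
  "one_suppression_unconditional smul x xs \<longleftrightarrow>
     (\<forall>A f. finite A \<longrightarrow> norm (f - proj smul x xs A f) \<le> norm f)"

definition one_symmetric_largest_coeffs ::
    "('f::real_normed_field \<Rightarrow> 'a::banach \<Rightarrow> 'a) \<Rightarrow> (nat \<Rightarrow> 'a) \<Rightarrow> (nat \<Rightarrow> 'a \<Rightarrow>\<^sub>L 'f) \<Rightarrow> bool" where
  "one_symmetric_largest_coeffs smul x xs \<longleftrightarrow>
     (\<forall>f A B \<epsilon> \<eta>.
        coeff_sup_norm xs f \<le> 1 \<and> finite A \<and> finite B \<and> card A \<le> card B \<and>
        A \<inter> B = {} \<and> supp xs f \<inter> (A \<union> B) = {} \<and>
        (\<forall>n\<in>A. norm (\<epsilon> n) = 1) \<and> (\<forall>n\<in>B. norm (\<eta> n) = 1) \<longrightarrow>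
        norm (f + signed_indicator smul x \<epsilon> A) \<le> norm (f + signed_indicator smul x \<eta> B))"

definition property_Q_star_one ::
    "('f::real_normed_field \<Rightarrow> 'a::banach \<Rightarrow> 'a) \<Rightarrow> (nat \<Rightarrow> 'a) \<Rightarrow> (nat \<Rightarrow> 'a \<Rightarrow>\<^sub>L 'f) \<Rightarrow> bool" where
  "property_Q_star_one smul x xs \<longleftrightarrow>
     (\<forall>f. \<forall>y\<in>finite_support xs. \<forall>A \<epsilon>.
        coeff_sup_norm xs f \<le> 1 \<and> finite A \<and>
        card A \<le> card {n \<in> supp xs y. norm (blinfun_apply (xs n) y) = 1} \<and>
        supp xs f \<inter> supp xs y = {} \<and> supp xs (f + y) \<inter> A = {} \<and>
        (\<forall>n\<in>A. norm (\<epsilon> n) = 1) \<longrightarrow>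
        norm (f + signed_indicator smul x \<epsilon> A) \<le> norm (f + y))"

end

theory Submission
  imports Defs
begin

text \<open>
  That \<open>1\<close>-greediness gives the equality for the first greedy error is clear, the greedy sum being a
  competitor in the best error. The three other ideas are the following.
  
  \<^item> \<^bold>\<open>The first greedy step already knows everything.\<close> If \<open>b\<close> exceeds all coordinates of \<open>h\<close> in modulus
    and \<open>h\<close> vanishes at \<open>j\<close>, the first greedy step on \<open>h + b x\<^sub>j\<close> leaves \<open>h\<close>. Comparison with the
    competitor \<open>- c x\<^sub>k\<close> gives \<open>\<parallel>h\<parallel> \<le> \<parallel>h + b x\<^sub>j + c x\<^sub>k\<parallel>\<close> (\<open>first_step\<close>). With \<open>k = j\<close> this is
    suppression of one coordinate; with \<open>h\<close> containing the term \<open>- c x\<^sub>k\<close>, and after letting \<open>|b|\<close>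
    decrease to \<open>1\<close>, it exchanges one unimodular term for another. Iteration over finite sets
    gives \<open>1\<close>-suppression unconditionality and \<open>1\<close>-symmetry.
  
  \<^item> \<^bold>\<open>Symmetry and unconditionality give greediness.\<close> Let \<open>\<Lambda>\<close> be the set of greedy indices, \<open>t\<close> the
    least modulus of a coordinate on \<open>\<Lambda>\<close>, and \<open>g\<close> the residual of a competitor supported on \<open>B\<close>. The greedy residual is
    \<open>h + P\<^sub>C f\<close> where \<open>C = B - \<Lambda>\<close> and \<open>h\<close> is what remains of \<open>f\<close> off \<open>\<Lambda> \<union> B\<close>. By convexity its coordinates on
    \<open>C\<close>, which are at most \<open>t\<close>, may be replaced by scalars of modulus exactly \<open>t\<close>
    (\<open>polydisc_le_torus\<close>); symmetry moves these to \<open>D = \<Lambda> - B\<close>; unconditionality lets them grow to the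
    coordinates of \<open>f\<close> on \<open>D\<close> (\<open>shrink_coords\<close>) and then adds the coordinates of \<open>g\<close> on \<open>B\<close>.
  
  \<^item> \<^bold>\<open>Property (Q*) packs both conditions into one.\<close> An empty \<open>A\<close> gives suppression, and a \<open>y\<close> with
    unimodular coordinates gives symmetry. Conversely, suppression cuts \<open>y\<close> down to its unimodular part, to
    which symmetry applies.
  
  A vector with empty support must be zero for the supremum norm of its coordinates to make sense.
  Suppression unconditionality and the density of the span force this (\<open>suppression_total\<close>); before
  unconditionality is available, the argument stays inside the span, where it is plain.
\<close>

locale M_basis = banach_space_over smul
  for smul :: "'f::real_normed_field \<Rightarrow> 'a::banach \<Rightarrow> 'a" +
  fixes x :: "nat \<Rightarrow> 'a" and xs :: "nat \<Rightarrow> 'a \<Rightarrow>\<^sub>L 'f"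
  assumes M_basis: "semi_normalized_M_basis smul x xs"
begin

abbreviation coord :: "nat \<Rightarrow> 'a \<Rightarrow> 'f" where
  "coord n f \<equiv> blinfun_apply (xs n) f"

abbreviation comb :: "(nat \<Rightarrow> 'f) \<Rightarrow> nat set \<Rightarrow> 'a" where
  "comb a A \<equiv> signed_indicator smul x a A"

section \<open>Coordinates and finite linear combinations\<close>

lemma coord_smul [simp]: "coord n (smul c f) = c * coord n f"
  using M_basis unfolding semi_normalized_M_basis_def biorthogonal_def dual_space_def by blast

lemma coord_x [simp]: "coord n (x j) = (if n = j then 1 else 0)"
  using M_basis unfolding semi_normalized_M_basis_def biorthogonal_def by blast

lemma coord_linear [simp]:
  "coord n (f + g) = coord n f + coord n g" "coord n (f - g) = coord n f - coord n g"
  "coord n 0 = 0"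
  by (simp_all add: blinfun.add_right blinfun.diff_right blinfun.zero_right)

lemma proj_conv_comb: "proj smul x xs A f = comb (\<lambda>j. coord j f) A"
  by (simp add: proj_def signed_indicator_def)

lemma comb_empty [simp]: "comb a {} = 0"
  by (simp add: signed_indicator_def)

lemma comb_insert: "finite A \<Longrightarrow> k \<notin> A \<Longrightarrow> comb a (insert k A) = smul (a k) (x k) + comb a A"
  by (simp add: signed_indicator_def)

lemma comb_cong: "(\<And>j. j \<in> A \<Longrightarrow> a j = b j) \<Longrightarrow> comb a A = comb b A"
  by (simp add: signed_indicator_def)

lemma comb_Un: "finite A \<Longrightarrow> finite B \<Longrightarrow> A \<inter> B = {} \<Longrightarrow> comb a (A \<union> B) = comb a A + comb a B"
  by (simp add: signed_indicator_def sum.union_disjoint)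

lemma comb_diff: "comb (\<lambda>j. a j - b j) A = comb a A - comb b A"
  by (simp add: signed_indicator_def scale_left_diff_distrib sum_subtractf)

lemma comb_scale: "smul c (comb a A) = comb (\<lambda>j. c * a j) A"
  by (simp add: signed_indicator_def scale_sum_right)

lemma coord_comb [simp]: "finite A \<Longrightarrow> coord n (comb a A) = (if n \<in> A then a n else 0)"
  by (induction A rule: finite_induct) (auto simp: comb_insert)

lemma norm_scale_of_real: "norm (smul (of_real r) f) = \<bar>r\<bar> * norm f"
  by (simp add: norm_scale)

lemma bounded_linear_proj: "bounded_linear (\<lambda>f. comb (\<lambda>j. coord j f) A)"
  unfolding signed_indicator_def
proof (rule bounded_linear_sum)
  fix j
  show "bounded_linear (\<lambda>f. smul (coord j f) (x j))"
  proof (rule bounded_linear_intro[where K = "norm (xs j) * norm (x j)"])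
    show "smul (coord j (f + g)) (x j) = smul (coord j f) (x j) + smul (coord j g) (x j)" for f g
      by (simp add: scale_left_distrib)
    show "smul (coord j (r *\<^sub>R f)) (x j) = r *\<^sub>R smul (coord j f) (x j)" for r f
      by (metis coord_smul scale_of_real scale_scale)
    show "norm (smul (coord j f) (x j)) \<le> norm f * (norm (xs j) * norm (x j))" for f
      using mult_right_mono[OF norm_blinfun[of "xs j" f] norm_ge_zero[of "x j"]]
      by (simp add: norm_scale mult_ac)
  qed
qed

lemma coords_bounded:
  obtains K where "K > 0" "\<And>n f. norm (coord n f) \<le> K * norm f"
proof -
  from M_basis obtain c1 c2 where c: "0 < c1" "\<And>n. c1 \<le> norm (xs n)" "\<And>n. norm (xs n) \<le> c2"
    unfolding semi_normalized_M_basis_def by blast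
  have "c2 > 0" using c(1) c(2)[of 0] c(3)[of 0] by linarith
  moreover have "norm (coord n f) \<le> c2 * norm f" for n f
    using norm_blinfun[of "xs n" f] mult_right_mono[OF c(3)[of n] norm_ge_zero[of f]] by linarith
  ultimately show ?thesis using that by blast
qed

lemma coords_of_vector_bounded:
  obtains t where "t > 0" "\<And>n. norm (coord n f) < t"
proof -
  obtain K where K: "K > 0" "\<And>n f. norm (coord n f) \<le> K * norm f"
    using coords_bounded by blast
  have "K * norm f + 1 > 0" using K(1) by (simp add: add_nonneg_pos)
  moreover have "norm (coord n f) < K * norm f + 1" for n using K(2)[of n f] by simp
  ultimately show ?thesis using that by blast
qed

text \<open>
  By biorthogonality, the coefficients in any finite expansion are the coordinates.
\<close>

lemma span_expansion:
  assumes "g \<in> span (range x)"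
  obtains A where "finite A" "g = comb (\<lambda>j. coord j g) A"
proof -
  have "\<exists>A a. finite A \<and> g = comb a A"
    using assms
  proof (induction rule: span_induct_alt)
    case base
    have "finite {} \<and> (0::'a) = comb (\<lambda>_. 0) {}" by simp
    then show ?case by blast
  next
    case (step c y z)
    then obtain k A a where k: "y = x k" and A: "finite A" "z = comb a A" by blast
    define A' where "A' = A - {k}"
    define b where "b = a(k := (if k \<in> A then a k + c else c))"
    have A': "finite A'" "k \<notin> A'" using A(1) by (auto simp: A'_def)
    have "comb b A' = comb a A'" by (rule comb_cong) (auto simp: b_def A'_def)
    then have b: "comb b (insert k A') = smul (b k) (x k) + comb a A'"
      using A' by (simp add: comb_insert)
    have "comb b (insert k A') = smul c y + z"
    proof (cases "k \<in> A")
      case True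
      then have "A = insert k A'" by (auto simp: A'_def)
      then have "z = smul (a k) (x k) + comb a A'" using A(2) A' by (simp add: comb_insert)
      then show ?thesis unfolding b using True k by (simp add: b_def scale_left_distrib)
    next
      case False
      then have "A' = A" by (auto simp: A'_def)
      then show ?thesis unfolding b using False A(2) k by (simp add: b_def)
    qed
    then show ?case using A'(1) by (metis finite_insert)
  qed
  then obtain A a where A: "finite A" "g = comb a A" by blast
  have "comb (\<lambda>j. coord j g) A = comb a A"
    by (rule comb_cong) (simp add: A)
  with A that show ?thesis by metis
qed

lemma span_dense: "\<exists>g. (\<forall>k. g k \<in> span (range x)) \<and> g \<longlonglongrightarrow> f"
proof -
  have "f \<in> closure (span (range x))"
    using M_basis unfolding semi_normalized_M_basis_def by simp
  then show ?thesis by (simp add: closure_sequential)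
qed

text \<open>
  The coordinates form a null sequence: they are uniformly bounded functionals, and off a finite set they
  do not distinguish \<open>f\<close> from an approximating vector of the span.
\<close>

lemma finite_large_coords:
  assumes "e > 0" shows "finite {n. e \<le> norm (coord n f)}"
proof -
  obtain K where K: "K > 0" "\<And>n f. norm (coord n f) \<le> K * norm f"
    using coords_bounded by blast
  obtain g where g: "\<And>k. g k \<in> span (range x)" "g \<longlonglongrightarrow> f" using span_dense by blast
  obtain k where k: "norm (g k - f) < e / K"
    using LIMSEQ_D[OF g(2), of "e / K"] assms K(1) by auto
  obtain A where A: "finite A" "g k = comb (\<lambda>j. coord j (g k)) A"
    using span_expansion[OF g(1)] by blast
  have "norm (coord n f) < e" if "n \<notin> A" for n
  proof -
    have "coord n (g k) = 0"
      using that A by (metis coord_comb)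
    then have "norm (coord n f) = norm (coord n (f - g k))" by simp
    also have "\<dots> \<le> K * norm (g k - f)" using K(2) by (metis norm_minus_commute)
    also have "\<dots> < e" using k K(1) by (simp add: field_simps)
    finally show ?thesis .
  qed
  then have "{n. e \<le> norm (coord n f)} \<subseteq> A" by force
  then show ?thesis using A(1) finite_subset by blast
qed

section \<open>The supremum norm of the coordinates\<close>

lemma coeff_sup_norm_le_imp:
  assumes "coeff_sup_norm xs f \<le> 1"
  shows "norm (coord n f) \<le> 1"
proof (cases "n \<in> supp xs f")
  case True
  obtain t where t: "\<And>n. norm (coord n f) < t" using coords_of_vector_bounded by blast
  have bdd: "bdd_above ((\<lambda>n. norm (coord n f)) ` supp xs f)"
    by (rule bdd_aboveI2[where M = t]) (simp add: t less_imp_le)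
  have "f \<noteq> 0" using True by (auto simp: supp_def)
  then show ?thesis
    using cSUP_upper[OF True bdd] assms by (simp add: coeff_sup_norm_def)
qed (simp add: supp_def)

text \<open>
  The second hypothesis excludes the supremum over the empty set, which is an unspecified real number.
\<close>

lemma coeff_sup_norm_leI:
  assumes "\<And>n. norm (coord n f) \<le> 1" "f \<noteq> 0 \<Longrightarrow> supp xs f \<noteq> {}"
  shows "coeff_sup_norm xs f \<le> 1"
  using assms by (auto simp: coeff_sup_norm_def intro!: cSUP_least)

lemma supp_nonempty_span:
  assumes "f \<in> span (range x)" "f \<noteq> 0" shows "supp xs f \<noteq> {}"
proof
  assume "supp xs f = {}"
  then have "coord n f = 0" for n by (auto simp: supp_def)
  moreover obtain A where "f = comb (\<lambda>j. coord j f) A"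
    using span_expansion[OF assms(1)] by blast
  ultimately have "f = comb (\<lambda>_. 0) A" by simp
  then show False using assms(2) by (simp add: signed_indicator_def)
qed

section \<open>Greedy orderings\<close>

text \<open>
  The strict order along which a greedy ordering of \<open>f\<close> enumerates indices.
\<close>

definition before :: "'a \<Rightarrow> nat \<Rightarrow> nat \<Rightarrow> bool" where
  "before f i k \<longleftrightarrow> norm (coord i f) > norm (coord k f) \<or>
     (norm (coord i f) = norm (coord k f) \<and> i < k)"

lemma before_imp_le: "before f i k \<Longrightarrow> norm (coord k f) \<le> norm (coord i f)"
  by (auto simp: before_def)

lemma is_greedy_ordering_iff:
  "is_greedy_ordering xs f \<rho> \<longleftrightarrow>
     supp xs f \<subseteq> range \<rho> \<and> (\<forall>j k. j < k \<longrightarrow> before f (\<rho> j) (\<rho> k))"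
  unfolding is_greedy_ordering_def before_def by (rule refl)

lemma before_irrefl: "\<not> before f i i"
  by (simp add: before_def)

text \<open>
  So \<open>before f\<close> well-orders the indices. If some coordinate on \<open>S\<close> is nonzero, only finitely many
  compete with it; otherwise \<open>before f\<close> is the usual order on \<open>S\<close>.
\<close>

lemma before_first_exists:
  assumes "S \<noteq> {}"
  shows "\<exists>i\<in>S. \<forall>k\<in>S. k \<noteq> i \<longrightarrow> before f i k"
proof (cases "\<forall>k\<in>S. coord k f = 0")
  case True
  have "(LEAST i. i \<in> S) \<in> S" using assms by (metis LeastI_ex all_not_in_conv)
  moreover have "before f (LEAST i. i \<in> S) k" if "k \<in> S" "k \<noteq> (LEAST i. i \<in> S)" for k
    using that True calculation Least_le[of "\<lambda>i. i \<in> S" k] by (simp add: before_def)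
  ultimately show ?thesis by blast
next
  case False
  then obtain n where n: "n \<in> S" "norm (coord n f) > 0" by auto
  define F where "F = {k \<in> S. norm (coord n f) \<le> norm (coord k f)}"
  have "finite F"
    by (rule finite_subset[OF _ finite_large_coords[OF n(2), of f]]) (auto simp: F_def)
  moreover have "n \<in> F" using n(1) by (simp add: F_def)
  ultimately have F: "finite F" "n \<in> F" .
  define M where "M = Max ((\<lambda>k. norm (coord k f)) ` F)"
  have M: "M \<in> (\<lambda>k. norm (coord k f)) ` F"
    unfolding M_def using F by (intro Max_in) auto
  have M_ge: "\<And>k. k \<in> F \<Longrightarrow> norm (coord k f) \<le> M"
    using F by (simp add: M_def)
  define i where "i = (LEAST i. i \<in> F \<and> norm (coord i f) = M)"
  have i: "i \<in> F" "norm (coord i f) = M"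
    using LeastI_ex[of "\<lambda>i. i \<in> F \<and> norm (coord i f) = M"] M by (auto simp: i_def)
  have "before f i k" if "k \<in> S" "k \<noteq> i" for k
  proof (cases "k \<in> F")
    case True
    have "i \<le> k" if "norm (coord k f) = M"
      unfolding i_def using True that by (intro Least_le) simp
    then show ?thesis
      using M_ge[OF True] i(2) \<open>k \<noteq> i\<close> by (auto simp: before_def)
  next
    case False
    then show ?thesis using that i(1) by (auto simp: before_def F_def)
  qed
  then show ?thesis using i(1) by (auto simp: F_def)
qed

text \<open>
  The first remaining index is taken again and again. An index of the support cannot be missed for ever, because it
  would be preceded by infinitely many indices whose coordinates are at least as large.
\<close>

lemma greedy_ordering_exists: "\<exists>\<rho>. is_greedy_ordering xs f \<rho>"
proof -
  define first where "first S = (SOME i. i \<in> S \<and> (\<forall>k\<in>S. k \<noteq> i \<longrightarrow> before f i k))" for S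
  have first_props: "first S \<in> S \<and> (\<forall>k\<in>S. k \<noteq> first S \<longrightarrow> before f (first S) k)" if "S \<noteq> {}" for S
    unfolding first_def by (rule someI_ex) (use before_first_exists[OF that] in blast)
  then have first: "\<And>S. S \<noteq> {} \<Longrightarrow> first S \<in> S"
      "\<And>S k. S \<noteq> {} \<Longrightarrow> k \<in> S \<Longrightarrow> k \<noteq> first S \<Longrightarrow> before f (first S) k"
    by blast+
  \<comment> \<open>\<open>T n\<close> is the set of the first \<open>n\<close> indices chosen.\<close>
  define T where "T = rec_nat {} (\<lambda>_ S. insert (first (- S)) S)"
  define \<rho> where "\<rho> n = first (- T n)" for n
  have T_0: "T 0 = {}" and T_Suc: "T (Suc n) = insert (\<rho> n) (T n)" for n
    by (simp_all add: T_def \<rho>_def)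
  have T_eq: "T n = \<rho> ` {..<n}" for n
    by (induction n) (simp_all add: T_0 T_Suc lessThan_Suc)
  have ne: "- T n \<noteq> {}" for n
  proof
    assume "- T n = {}"
    then have "T n = UNIV" by blast
    moreover have "finite (T n)" by (simp add: T_eq)
    ultimately show False by simp
  qed
  have new: "\<rho> n \<notin> T n" for n using first(1)[OF ne[of n]] by (simp add: \<rho>_def)
  have bef: "before f (\<rho> j) n" if "n \<notin> T (Suc j)" for j n
    using first(2)[OF ne[of j], of n] that by (auto simp: T_Suc \<rho>_def)
  have mono: "before f (\<rho> j) (\<rho> k)" if "j < k" for j k
  proof (rule bef)
    have "T (Suc j) \<subseteq> T k" using that by (auto simp: T_eq)
    then show "\<rho> k \<notin> T (Suc j)" using new by blast
  qed
  have inj: "inj \<rho>"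
    by (rule linorder_injI) (metis mono before_irrefl)
  have "n \<in> range \<rho>" if n: "n \<in> supp xs f" for n
  proof (rule ccontr)
    assume "n \<notin> range \<rho>"
    then have "before f (\<rho> j) n" for j by (intro bef) (auto simp: T_eq)
    then have "range \<rho> \<subseteq> {k. norm (coord n f) \<le> norm (coord k f)}"
      using before_imp_le by blast
    moreover have "finite {k. norm (coord n f) \<le> norm (coord k f)}"
      using n by (intro finite_large_coords) (simp add: supp_def)
    ultimately have "finite (range \<rho>)" by (rule finite_subset)
    then show False using inj by (simp add: finite_image_iff)
  qed
  then have "is_greedy_ordering xs f \<rho>"
    using mono by (auto simp: is_greedy_ordering_iff)
  then show ?thesis by blast
qed

text \<open>
  A greedy sum is a projection onto indices of largest coordinates. This is the only property of the
  chosen ordering on which the comparison with the best error rests.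
\<close>

lemma greedy_sum_eq_proj:
  obtains \<Lambda> where "finite \<Lambda>" "card \<Lambda> = m" "greedy_sum smul x xs m f = comb (\<lambda>j. coord j f) \<Lambda>"
    "\<And>j n. j \<in> \<Lambda> \<Longrightarrow> n \<notin> \<Lambda> \<Longrightarrow> norm (coord n f) \<le> norm (coord j f)"
proof -
  define \<rho> where "\<rho> = (SOME \<rho>. is_greedy_ordering xs f \<rho>)"
  have "is_greedy_ordering xs f \<rho>"
    unfolding \<rho>_def using greedy_ordering_exists by (rule someI_ex)
  then have \<rho>: "supp xs f \<subseteq> range \<rho>" "\<And>j k. j < k \<Longrightarrow> before f (\<rho> j) (\<rho> k)"
    by (auto simp: is_greedy_ordering_iff)
  have inj: "inj \<rho>"
    by (rule linorder_injI) (metis \<rho>(2) before_irrefl)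
  show ?thesis
  proof (rule that[of "\<rho> ` {..<m}"])
    show "card (\<rho> ` {..<m}) = m"
      by (simp add: card_image inj_on_subset[OF inj])
    show "greedy_sum smul x xs m f = comb (\<lambda>j. coord j f) (\<rho> ` {..<m})"
      by (simp add: greedy_sum_def Let_def \<rho>_def[symmetric] signed_indicator_def
          sum.reindex inj_on_subset[OF inj])
    show "norm (coord n f) \<le> norm (coord j f)" if jn: "j \<in> \<rho> ` {..<m}" "n \<notin> \<rho> ` {..<m}" for j n
    proof (cases "n \<in> range \<rho>")
      case True
      then obtain k where k: "n = \<rho> k" by blast
      obtain i where i: "j = \<rho> i" "i < m" using jn(1) by blast
      have "i < k" using jn(2) k i by (metis imageI leI lessThan_iff order.strict_trans1 not_le)
      then show ?thesis using before_imp_le[OF \<rho>(2)] k i by blast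
    next
      case False
      then have "n \<notin> supp xs f" using \<rho>(1) by blast
      then show ?thesis by (simp add: supp_def)
    qed
  qed simp
qed

lemma greedy_sum_1_strict_max:
  assumes "\<And>n. n \<noteq> j \<Longrightarrow> norm (coord n f) < norm (coord j f)"
  shows "greedy_sum smul x xs 1 f = smul (coord j f) (x j)"
proof -
  obtain \<Lambda> where \<Lambda>: "finite \<Lambda>" "card \<Lambda> = 1"
    "greedy_sum smul x xs 1 f = comb (\<lambda>j. coord j f) \<Lambda>"
    "\<And>j n. j \<in> \<Lambda> \<Longrightarrow> n \<notin> \<Lambda> \<Longrightarrow> norm (coord n f) \<le> norm (coord j f)"
    using greedy_sum_eq_proj[of 1 f] by blast
  from \<Lambda>(2) obtain i where i: "\<Lambda> = {i}" by (auto simp: card_1_singleton_iff)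
  have "i = j"
  proof (rule ccontr)
    assume "i \<noteq> j"
    then show False using \<Lambda>(4)[of i j] assms[of i] i by auto
  qed
  then show ?thesis using \<Lambda>(3) i by (simp add: signed_indicator_def)
qed

lemma best_error_le:
  assumes "finite B" "card B \<le> m"
  shows "best_error smul x m f \<le> norm (f - comb a B)"
  unfolding best_error_def signed_indicator_def
proof (rule cInf_lower)
  show "bdd_below {norm (f - (\<Sum>j\<in>B. smul (a j) (x j))) | B a. finite B \<and> card B \<le> m}"
    by (rule bdd_belowI[where m = 0]) auto
qed (use assms in blast)

lemma best_error_geI:
  assumes "\<And>B a. finite B \<Longrightarrow> card B \<le> m \<Longrightarrow> r \<le> norm (f - comb a B)"
  shows "r \<le> best_error smul x m f"
  unfolding best_error_def
proof (rule cInf_greatest)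
  show "{norm (f - (\<Sum>j\<in>B. smul (a j) (x j))) | B a. finite B \<and> card B \<le> m} \<noteq> {}"
  proof -
    have "finite ({} :: nat set) \<and> card ({} :: nat set) \<le> m" by simp
    then show ?thesis by blast
  qed
qed (use assms in \<open>auto simp: signed_indicator_def\<close>)

section \<open>Consequences of suppression unconditionality\<close>

lemma suppressD:
  assumes "one_suppression_unconditional smul x xs" "finite A"
  shows "norm (f - comb (\<lambda>j. coord j f) A) \<le> norm f"
  using assms by (simp add: one_suppression_unconditional_def proj_conv_comb)

text \<open>
  The form in which suppression is mostly used: terms at free positions do not decrease the norm.
\<close>

lemma suppress_comb:
  assumes "one_suppression_unconditional smul x xs" "finite A" "\<And>n. n \<in> A \<Longrightarrow> coord n f = 0"
  shows "norm f \<le> norm (f + comb a A)"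
proof -
  have "comb (\<lambda>j. coord j (f + comb a A)) A = comb a A"
    by (rule comb_cong) (simp add: assms)
  then show ?thesis using suppressD[OF assms(1,2), of "f + comb a A"] by simp
qed

text \<open>
  If \<open>f\<close> has no coordinates and \<open>g\<close> in the span approximates it, then \<open>f\<close> arises from \<open>f - g\<close> by
  suppressing finitely many coordinates. Hence the norm of \<open>f\<close> is at most that of the arbitrarily small \<open>f - g\<close>.
\<close>

lemma suppression_total:
  assumes "one_suppression_unconditional smul x xs" "\<And>n. coord n f = 0"
  shows "f = 0"
proof -
  obtain g where g: "\<And>k. g k \<in> span (range x)" "g \<longlonglongrightarrow> f" using span_dense by blast
  have "norm f \<le> norm (f - g k)" for k
  proof -
    obtain A where A: "finite A" "g k = comb (\<lambda>j. coord j (g k)) A"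
      using span_expansion[OF g(1)] by blast
    have "norm f \<le> norm (f + comb (\<lambda>j. - coord j (g k)) A)"
      by (rule suppress_comb) (use assms A in auto)
    moreover have "comb (\<lambda>j. - coord j (g k)) A = - g k"
      using comb_scale[of "-1" "\<lambda>j. coord j (g k)" A] A(2) by simp
    ultimately show ?thesis by simp
  qed
  moreover have "(\<lambda>k. norm (f - g k)) \<longlonglongrightarrow> 0"
    using tendsto_norm[OF tendsto_diff[OF tendsto_const[of f] g(2)]] by simp
  ultimately have "norm f \<le> 0" by (intro LIMSEQ_le_const) auto
  then show ?thesis by simp
qed

lemma suppression_coeff_sup_norm:
  assumes "one_suppression_unconditional smul x xs" "\<And>n. norm (coord n f) \<le> 1"
  shows "coeff_sup_norm xs f \<le> 1"
  using assms by (intro coeff_sup_norm_leI) (auto simp: supp_def intro: suppression_total)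

lemma finite_support_expansion:
  assumes "one_suppression_unconditional smul x xs" "finite A" "supp xs y \<subseteq> A"
  shows "y = comb (\<lambda>j. coord j y) A"
proof -
  have "y - comb (\<lambda>j. coord j y) A = 0"
    by (rule suppression_total[OF assms(1)]) (use assms(2,3) in \<open>auto simp: supp_def\<close>)
  then show ?thesis by simp
qed

text \<open>
  One coordinate at a time: scaling it by \<open>s \<in> [0, 1]\<close> gives a convex combination of the vector itself and
  the vector with this coordinate suppressed.
\<close>

lemma shrink_coords:
  assumes U: "one_suppression_unconditional smul x xs" and "finite D"
    and "\<And>j. j \<in> D \<Longrightarrow> coord j h = 0"
    and "\<And>j. j \<in> D \<Longrightarrow> 0 \<le> s j \<and> s j \<le> 1"
  shows "norm (h + comb (\<lambda>j. of_real (s j) * b j) D) \<le> norm (h + comb b D)"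
  using assms(2-)
proof (induction D arbitrary: h rule: finite_induct)
  case (insert k D)
  let ?c = "\<lambda>j. of_real (s j) * b j"
  define w where "w = h + comb b D"
  have s: "0 \<le> s k" "s k \<le> 1" using insert.prems by auto
  have "coord k w = 0" using insert by (simp add: w_def)
  then have w: "norm w \<le> norm (w + smul (b k) (x k))"
    using suppress_comb[OF U, of "{k}" w b] by (simp add: comb_insert)
  have "norm (h + comb ?c (insert k D)) = norm ((h + smul (?c k) (x k)) + comb ?c D)"
    using insert.hyps by (simp add: comb_insert add.assoc)
  also have "\<dots> \<le> norm ((h + smul (?c k) (x k)) + comb b D)"
    using insert.prems insert.hyps by (intro insert.IH) auto
  also have "(h + smul (?c k) (x k)) + comb b D
      = s k *\<^sub>R (w + smul (b k) (x k)) + (1 - s k) *\<^sub>R w"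
    by (simp add: w_def scale_of_real[symmetric] scale_right_distrib scale_left_diff_distrib)
  also have "norm \<dots> \<le> s k * norm (w + smul (b k) (x k)) + (1 - s k) * norm w"
    using norm_triangle_ineq[of "s k *\<^sub>R (w + smul (b k) (x k))" "(1 - s k) *\<^sub>R w"] s by simp
  also have "\<dots> \<le> s k * norm (w + smul (b k) (x k)) + (1 - s k) * norm (w + smul (b k) (x k))"
    using w s by (intro add_left_mono mult_left_mono) auto
  also have "\<dots> = norm (h + comb b (insert k D))"
    using insert.hyps by (simp add: w_def comb_insert algebra_simps)
  finally show ?case .
qed simp

section \<open>Coefficients of maximal modulus dominate\<close>

text \<open>
  Each point of the disc of radius \<open>t\<close> lies between two antipodal points of the circle, and balls are convex.
  Over any real normed field the two points are found on the line through the scalar and the origin.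
\<close>

lemma disc_le_circle:
  assumes t: "t > 0" and a: "norm a \<le> t"
    and M: "\<And>u. norm u = t \<Longrightarrow> norm (h + smul u v) \<le> M"
  shows "norm (h + smul a v) \<le> M"
proof -
  obtain u where u: "norm u = 1" "a = of_real (norm a) * u"
  proof (cases "a = 0")
    case False
    then show ?thesis by (intro that[of "a / of_real (norm a)"]) (auto simp: norm_divide)
  qed (use that[of 1] in auto)
  define r where "r = 1 / 2 + norm a / (2 * t)"
  have r: "0 \<le> r" "r \<le> 1" using t a by (auto simp: r_def field_simps)
  let ?p = "h + smul (of_real t * u) v" and ?q = "h + smul (- (of_real t * u)) v"
  have "of_real r * (of_real t * u) - of_real (1 - r) * (of_real t * u) = of_real ((2 * r - 1) * t) * u"
    by (simp add: algebra_simps)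
  also have "(2 * r - 1) * t = norm a" using t by (simp add: r_def field_simps)
  finally have "smul a v = smul (of_real r * (of_real t * u)) v - smul (of_real (1 - r) * (of_real t * u)) v"
    using u(2) by (metis scale_left_diff_distrib)
  then have "h + smul a v = r *\<^sub>R ?p + (1 - r) *\<^sub>R ?q"
    by (simp add: scale_of_real[symmetric] scale_right_distrib scale_left_diff_distrib scale_right_diff_distrib)
  moreover have "?p \<in> cball 0 M" "?q \<in> cball 0 M"
    using M[of "of_real t * u"] M[of "- (of_real t * u)"] u(1) t
    by (simp_all only: mem_cball_0 norm_mult norm_minus_cancel norm_of_real abs_of_pos mult_1_right)
  ultimately have "h + smul a v \<in> cball 0 M"
    using convexD[OF convex_cball, of ?p 0 M ?q r "1 - r"] r by simp
  then show ?thesis by simp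
qed

lemma polydisc_le_torus:
  assumes "finite C" "t > 0" "\<And>j. j \<in> C \<Longrightarrow> norm (a j) \<le> t"
    and "\<And>\<epsilon>. (\<And>j. j \<in> C \<Longrightarrow> norm (\<epsilon> j) = t) \<Longrightarrow> norm (h + comb \<epsilon> C) \<le> M"
  shows "norm (h + comb a C) \<le> M"
  using assms(1,3,4)
proof (induction C arbitrary: h rule: finite_induct)
  case (insert k C)
  have "norm ((h + comb a C) + smul (a k) (x k)) \<le> M"
  proof (rule disc_le_circle[OF assms(2)])
    show "norm (a k) \<le> t" using insert.prems by simp
    fix u :: 'f assume u: "norm u = t"
    have "norm ((h + smul u (x k)) + comb a C) \<le> M"
    proof (rule insert.IH)
      fix \<epsilon> :: "nat \<Rightarrow> 'f" assume \<epsilon>: "\<And>j. j \<in> C \<Longrightarrow> norm (\<epsilon> j) = t"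
      have "comb (\<epsilon>(k := u)) C = comb \<epsilon> C" using insert.hyps by (intro comb_cong) auto
      then have "h + comb (\<epsilon>(k := u)) (insert k C) = (h + smul u (x k)) + comb \<epsilon> C"
        using comb_insert[OF insert.hyps(1,2), of "\<epsilon>(k := u)"]
        by (simp only: fun_upd_same add.assoc)
      moreover have "norm (h + comb (\<epsilon>(k := u)) (insert k C)) \<le> M"
        using u \<epsilon> by (intro insert.prems(2)) auto
      ultimately show "norm ((h + smul u (x k)) + comb \<epsilon> C) \<le> M" by (simp add: add.assoc)
    qed (use insert.prems in auto)
    then show "norm ((h + comb a C) + smul u (x k)) \<le> M" by (simp add: algebra_simps)
  qed
  then show ?case using insert.hyps by (simp add: comb_insert algebra_simps)
qed simp

lemma symmetric_scaled:
  assumes S: "one_symmetric_largest_coeffs smul x xs" and U: "one_suppression_unconditional smul x xs"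
    and t: "t > 0" and h: "\<And>n. norm (coord n h) \<le> t" "\<And>n. n \<in> C \<union> D \<Longrightarrow> coord n h = 0"
    and fin: "finite C" "finite D" "card C \<le> card D" "C \<inter> D = {}"
    and \<epsilon>: "\<And>n. n \<in> C \<Longrightarrow> norm (\<epsilon> n) = t" and \<eta>: "\<And>n. n \<in> D \<Longrightarrow> norm (\<eta> n) = t"
  shows "norm (h + comb \<epsilon> C) \<le> norm (h + comb \<eta> D)"
proof -
  let ?s = "of_real (1 / t) :: 'f"
  have "norm (smul ?s h + comb (\<lambda>j. ?s * \<epsilon> j) C) \<le> norm (smul ?s h + comb (\<lambda>j. ?s * \<eta> j) D)"
  proof (rule S[unfolded one_symmetric_largest_coeffs_def, rule_format], intro conjI ballI)
    show "coeff_sup_norm xs (smul ?s h) \<le> 1"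
      by (rule suppression_coeff_sup_norm[OF U]) (use h t in \<open>simp add: norm_mult norm_divide\<close>)
  qed (use h(2) fin \<epsilon> \<eta> t in \<open>auto simp: supp_def norm_mult norm_divide\<close>)
  then have "norm (smul ?s (h + comb \<epsilon> C)) \<le> norm (smul ?s (h + comb \<eta> D))"
    by (simp only: scale_right_distrib comb_scale)
  then show ?thesis using t by (simp only: norm_scale_of_real) (simp add: divide_le_cancel)
qed

section \<open>Symmetry and unconditionality imply greediness\<close>

text \<open>
  If the least greedy coordinate vanishes, then \<open>f\<close> equals its greedy sum. Otherwise the comparison runs from the
  greedy residual \<open>h + P\<^sub>C f\<close> to \<open>h + P\<^sub>D f\<close> through vectors whose coordinates on \<open>C\<close> or \<open>D\<close> have modulus exactly
  \<open>t\<close>; finally \<open>h + P\<^sub>D f\<close> is the competitor's residual with its coordinates on \<open>B\<close> suppressed.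
\<close>

lemma symmetric_suppression_imp_greedy:
  assumes S: "one_symmetric_largest_coeffs smul x xs" and U: "one_suppression_unconditional smul x xs"
  shows "one_greedy smul x xs"
  unfolding one_greedy_def
proof (intro allI impI)
  fix m :: nat and f :: 'a
  assume "m \<ge> 1"
  obtain \<Lambda> where \<Lambda>: "finite \<Lambda>" "card \<Lambda> = m"
    "greedy_sum smul x xs m f = comb (\<lambda>j. coord j f) \<Lambda>"
    "\<And>j n. j \<in> \<Lambda> \<Longrightarrow> n \<notin> \<Lambda> \<Longrightarrow> norm (coord n f) \<le> norm (coord j f)"
    using greedy_sum_eq_proj[of m f] by blast
  let ?f = "\<lambda>j. coord j f"
  define t where "t = Min ((\<lambda>j. norm (?f j)) ` \<Lambda>)"
  have "\<Lambda> \<noteq> {}" using \<open>m \<ge> 1\<close> \<Lambda>(2) by auto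
  then have "t \<in> (\<lambda>j. norm (?f j)) ` \<Lambda>" unfolding t_def using \<Lambda>(1) by (intro Min_in) auto
  then obtain i where i: "i \<in> \<Lambda>" "t = norm (?f i)" by blast
  have t_out: "norm (?f n) \<le> t" if "n \<notin> \<Lambda>" for n using \<Lambda>(4)[OF i(1) that] i(2) by simp
  have t_in: "t \<le> norm (?f j)" if "j \<in> \<Lambda>" for j using \<Lambda>(1) that by (simp add: t_def)
  have "t \<ge> 0" using i(2) by simp
  show "norm (f - greedy_sum smul x xs m f) \<le> best_error smul x m f"
  proof (rule best_error_geI)
    fix B :: "nat set" and a :: "nat \<Rightarrow> 'f"
    assume B: "finite B" "card B \<le> m"
    show "norm (f - greedy_sum smul x xs m f) \<le> norm (f - comb a B)"
    proof (cases "t = 0")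
      case True
      then have "coord n f = 0" if "n \<notin> \<Lambda>" for n using t_out[OF that] by simp
      then have "supp xs f \<subseteq> \<Lambda>" unfolding supp_def by blast
      then show ?thesis
        using finite_support_expansion[OF U \<Lambda>(1), of f] \<Lambda>(3) by simp
    next
      case False
      with \<open>t \<ge> 0\<close> have t: "t > 0" by simp
      define C where "C = B - \<Lambda>"
      define D where "D = \<Lambda> - B"
      have CD: "finite C" "finite D" "C \<inter> D = {}" "card C \<le> card D"
        using B \<Lambda>(1,2) card_le_sym_Diff[OF B(1) \<Lambda>(1)] unfolding C_def D_def by simp_all blast
      define h where "h = f - comb ?f (\<Lambda> \<union> B)"
      have h: "coord n h = (if n \<in> \<Lambda> \<union> B then 0 else ?f n)" for n
        using B(1) \<Lambda>(1) by (simp add: h_def)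
      have "\<Lambda> \<union> B = \<Lambda> \<union> C" "\<Lambda> \<union> B = B \<union> D" by (auto simp: C_def D_def)
      moreover have "comb ?f (\<Lambda> \<union> C) = comb ?f \<Lambda> + comb ?f C"
        using CD(1) \<Lambda>(1) by (intro comb_Un) (auto simp: C_def)
      moreover have "comb ?f (B \<union> D) = comb ?f B + comb ?f D"
        using CD(2) B(1) by (intro comb_Un) (auto simp: D_def)
      ultimately have h1: "h = f - (comb ?f \<Lambda> + comb ?f C)" and h2: "h = f - (comb ?f B + comb ?f D)"
        by (simp_all only: h_def)
      have hC: "h + comb ?f C = f - comb ?f \<Lambda>" unfolding h1 by simp
      have hD: "h + comb ?f D = f - comb ?f B" unfolding h2 by simp
      have "norm (h + comb ?f C) \<le> norm (h + comb ?f D)"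
      proof (rule polydisc_le_torus[OF CD(1) t])
        show "norm (?f j) \<le> t" if "j \<in> C" for j using t_out[of j] that by (simp add: C_def)
      next
        fix \<epsilon> :: "nat \<Rightarrow> 'f" assume \<epsilon>: "\<And>j. j \<in> C \<Longrightarrow> norm (\<epsilon> j) = t"
        \<comment> \<open>the coordinates of \<open>f\<close>, pulled back radially to modulus \<open>t\<close>\<close>
        let ?\<eta> = "\<lambda>j. of_real (t / norm (?f j)) * ?f j"
        have "norm (h + comb \<epsilon> C) \<le> norm (h + comb ?\<eta> D)"
        proof (rule symmetric_scaled[OF S U t])
          show "norm (coord n h) \<le> t" for n using h[of n] t_out[of n] t by simp
          show "coord n h = 0" if "n \<in> C \<union> D" for n using that h[of n] by (auto simp: C_def D_def)
          show "norm (?\<eta> n) = t" if "n \<in> D" for n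
          proof -
            have "?f n \<noteq> 0" using that t_in[of n] t by (auto simp: D_def)
            then show ?thesis using t by (simp add: norm_mult norm_divide)
          qed
        qed (use CD \<epsilon> in simp_all)
        also have "\<dots> \<le> norm (h + comb ?f D)"
        proof (rule shrink_coords[OF U CD(2)])
          show "0 \<le> t / norm (?f j) \<and> t / norm (?f j) \<le> 1" if "j \<in> D" for j
            using that t_in[of j] t by (auto simp: D_def divide_le_eq_1)
        qed (use h in \<open>auto simp: D_def\<close>)
        finally show "norm (h + comb \<epsilon> C) \<le> norm (h + comb ?f D)" .
      qed
      also have "h + comb ?f D = (f - comb a B) - comb (\<lambda>j. coord j (f - comb a B)) B"
      proof -
        have "comb (\<lambda>j. coord j (f - comb a B)) B = comb (\<lambda>j. ?f j - a j) B"
          using B(1) by (intro comb_cong) simp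
        then show ?thesis by (simp add: hD comb_diff)
      qed
      also have "norm \<dots> \<le> norm (f - comb a B)" by (rule suppressD[OF U B(1)])
      finally show ?thesis by (simp add: hC \<Lambda>(3))
    qed
  qed
qed

lemma greedy_imp_first_error:
  assumes "one_greedy smul x xs"
  shows "norm (f - greedy_sum smul x xs 1 f) = best_error smul x 1 f"
proof (rule antisym)
  show "norm (f - greedy_sum smul x xs 1 f) \<le> best_error smul x 1 f"
    using assms by (simp add: one_greedy_def)
  obtain \<Lambda> where \<Lambda>: "finite \<Lambda>" "card \<Lambda> = 1"
    "greedy_sum smul x xs 1 f = comb (\<lambda>j. coord j f) \<Lambda>"
    by (rule greedy_sum_eq_proj[of 1 f]) (rule that)
  show "best_error smul x 1 f \<le> norm (f - greedy_sum smul x xs 1 f)"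
    unfolding \<Lambda>(3) by (rule best_error_le) (simp_all only: \<Lambda>(1,2))
qed

section \<open>The first greedy step determines symmetry and unconditionality\<close>

text \<open>
  The first greedy step on \<open>h + b x\<^sub>j\<close> removes \<open>b x\<^sub>j\<close>, so its error \<open>\<parallel>h\<parallel>\<close> is at most the error of any other
  one-term approximation. The strict inequality rules out ties.
\<close>

lemma first_step:
  assumes E: "\<forall>f. norm (f - greedy_sum smul x xs 1 f) = best_error smul x 1 f"
    and h: "coord j h = 0" and b: "\<And>n. norm (coord n h) < norm b"
  shows "norm h \<le> norm (h + smul b (x j) + smul c (x k))"
proof -
  let ?g = "h + smul b (x j)"
  have g: "coord j ?g = b" "\<And>n. n \<noteq> j \<Longrightarrow> coord n ?g = coord n h" using h by auto
  have "greedy_sum smul x xs 1 ?g = smul b (x j)"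
    using greedy_sum_1_strict_max[of j ?g] g b by simp
  then have "norm h = best_error smul x 1 ?g" using E[rule_format, of ?g] by simp
  also have "\<dots> \<le> norm (?g - comb (\<lambda>_. - c) {k})" by (rule best_error_le) auto
  finally show ?thesis by (simp add: signed_indicator_def)
qed

text \<open>
  A coordinate \<open>f\<^sub>j\<close> is removed by first replacing it with a coordinate \<open>t\<close> so large that the greedy step
  must select it; changing \<open>t\<close> back to \<open>f\<^sub>j\<close> is one of the competing approximations.
\<close>

lemma first_error_imp_suppression:
  assumes E: "\<forall>f. norm (f - greedy_sum smul x xs 1 f) = best_error smul x 1 f"
  shows "one_suppression_unconditional smul x xs"
  unfolding one_suppression_unconditional_def
proof (intro allI impI)
  have single: "norm (f - smul (coord j f) (x j)) \<le> norm f" for f j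
  proof -
    let ?h = "f - smul (coord j f) (x j)"
    obtain t where t: "t > 0" "\<And>n. norm (coord n ?h) < t" using coords_of_vector_bounded by blast
    have "norm ?h \<le> norm (?h + smul (of_real t) (x j) + smul (coord j f - of_real t) (x j))"
      by (rule first_step[OF E]) (use t in auto)
    then show ?thesis by (simp add: scale_left_diff_distrib)
  qed
  fix A :: "nat set" and f :: 'a
  assume "finite A"
  then show "norm (f - proj smul x xs A f) \<le> norm f"
    unfolding proj_conv_comb
  proof (induction A rule: finite_induct)
    case (insert k A)
    let ?g = "f - comb (\<lambda>j. coord j f) A"
    have "coord k ?g = coord k f" using insert.hyps by simp
    then have eq: "f - comb (\<lambda>j. coord j f) (insert k A) = ?g - smul (coord k ?g) (x k)"
      using insert.hyps by (simp add: comb_insert)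
    show ?case unfolding eq using single[of ?g k] insert.IH by (rule order_trans)
  qed simp
qed

text \<open>
  The vector \<open>h + u x\<^sub>j + b x\<^sub>k\<close> with \<open>b\<close> slightly longer than \<open>v\<close> loses the term at \<open>k\<close> in its greedy step, whereas
  the competitor removes the term at \<open>j\<close>. The lengthening is what breaks the tie; its contribution to the norm
  is made smaller than a given \<open>d\<close>.
\<close>

lemma first_error_imp_swap:
  assumes E: "\<forall>f. norm (f - greedy_sum smul x xs 1 f) = best_error smul x 1 f"
    and h: "\<And>n. norm (coord n h) \<le> 1" "coord j h = 0" "coord k h = 0" "j \<noteq> k"
    and u: "norm u = 1" "norm v = 1"
  shows "norm (h + smul u (x j)) \<le> norm (h + smul v (x k))"
proof -
  have "norm (h + smul u (x j)) \<le> norm (h + smul v (x k)) + d" if d: "d > 0" for d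
  proof -
    let ?d = "d / (1 + norm (x k))"
    have pos: "1 + norm (x k) > 0" by (simp add: add_pos_nonneg)
    have d': "?d > 0" using d pos by simp
    let ?b = "of_real (1 + ?d) * v" and ?g = "h + smul u (x j)"
    have nb: "norm ?b = 1 + ?d" using d' u(2) by (simp only: norm_mult norm_of_real) simp
    have "norm ?g \<le> norm (?g + smul ?b (x k) + smul (- u) (x j))"
    proof (rule first_step[OF E])
      show "coord k ?g = 0" using h by simp
      show "norm (coord n ?g) < norm ?b" for n
        unfolding nb using h(1)[of n] h(2) u(1) d' by (cases "n = j") auto
    qed
    also have "\<dots> = norm ((h + smul v (x k)) + smul (of_real ?d * v) (x k))"
      by (simp add: scale_left_distrib distrib_right add.assoc)
    also have "\<dots> \<le> norm (h + smul v (x k)) + norm (smul (of_real ?d * v) (x k))"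
      by (rule norm_triangle_ineq)
    also have "norm (smul (of_real ?d * v) (x k)) = ?d * norm (x k)"
      using d' u(2) by (simp only: norm_scale norm_mult norm_of_real)
    also have "?d * norm (x k) \<le> d" using d pos by (simp add: field_simps)
    finally show ?thesis by simp
  qed
  then show ?thesis by (rule field_le_epsilon)
qed

text \<open>
  The elements of \<open>A\<close> are exchanged one by one for elements of \<open>B\<close>. All intermediate vectors keep
  coordinates of modulus at most one, as each exchange requires; the surplus elements of \<open>B\<close> are accounted for by
  suppression.
\<close>

lemma first_error_imp_symmetric:
  assumes E: "\<forall>f. norm (f - greedy_sum smul x xs 1 f) = best_error smul x 1 f"
  shows "one_symmetric_largest_coeffs smul x xs"
proof -
  have U: "one_suppression_unconditional smul x xs" by (rule first_error_imp_suppression[OF E])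
  have swap_all: "norm (f + comb \<epsilon> A) \<le> norm (f + comb \<eta> B)"
    if "finite A" "\<And>n. norm (coord n f) \<le> 1" "finite B" "card A \<le> card B"
      "A \<inter> B = {}" "\<And>n. n \<in> A \<union> B \<Longrightarrow> coord n f = 0"
      "\<And>n. n \<in> A \<Longrightarrow> norm (\<epsilon> n) = 1" "\<And>n. n \<in> B \<Longrightarrow> norm (\<eta> n) = 1"
    for f A B \<epsilon> \<eta>
    using that
  proof (induction A arbitrary: f B rule: finite_induct)
    case empty
    then show ?case using suppress_comb[OF U, of B f \<eta>] by simp
  next
    case (insert j A)
    then obtain k where k: "k \<in> B" by fastforce
    define B' where "B' = B - {k}"
    have B: "B = insert k B'" "finite B'" "k \<notin> B'" using k insert.prems by (auto simp: B'_def)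
    let ?h = "f + comb \<eta> B'"
    have jk: "j \<noteq> k" "j \<notin> B'" using insert.prems(4) k by (auto simp: B'_def)
    have "norm (f + comb \<epsilon> (insert j A)) = norm ((f + smul (\<epsilon> j) (x j)) + comb \<epsilon> A)"
      using insert.hyps by (simp add: comb_insert add.assoc)
    also have "\<dots> \<le> norm ((f + smul (\<epsilon> j) (x j)) + comb \<eta> B')"
    proof (rule insert.IH)
      show "norm (coord n (f + smul (\<epsilon> j) (x j))) \<le> 1" for n
        using insert.prems(1)[of n] insert.prems(5)[of j] insert.prems(6)[of j] by simp
      show "card A \<le> card B'" using insert.prems(3) insert.hyps B by simp
    qed (use insert.prems insert.hyps B jk in auto)
    also have "\<dots> = norm (?h + smul (\<epsilon> j) (x j))" by (simp add: algebra_simps)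
    also have "\<dots> \<le> norm (?h + smul (\<eta> k) (x k))"
    proof (rule first_error_imp_swap[OF E])
      show "norm (coord n ?h) \<le> 1" for n
        using insert.prems(1)[of n] insert.prems(5)[of n] insert.prems(7)[of n] B
        by (cases "n \<in> B'") auto
    qed (use insert.prems jk B in auto)
    also have "\<dots> = norm (f + comb \<eta> B)" using B by (simp add: comb_insert algebra_simps)
    finally show ?case .
  qed
  show ?thesis
    unfolding one_symmetric_largest_coeffs_def
  proof (intro allI impI, elim conjE)
    fix f A B and \<epsilon> \<eta> :: "nat \<Rightarrow> 'f"
    assume "coeff_sup_norm xs f \<le> 1" "finite A" "finite B" "card A \<le> card B"
      "A \<inter> B = {}" "supp xs f \<inter> (A \<union> B) = {}"
      "\<forall>n\<in>A. norm (\<epsilon> n) = 1" "\<forall>n\<in>B. norm (\<eta> n) = 1"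
    then show "norm (f + comb \<epsilon> A) \<le> norm (f + comb \<eta> B)"
      by (intro swap_all) (auto simp: supp_def coeff_sup_norm_le_imp)
  qed
qed

section \<open>Property (Q*)\<close>

text \<open>
  Suppression reduces \<open>f + y\<close> to \<open>f + P\<^sub>B y\<close> with \<open>B\<close> the set where \<open>y\<close> has unimodular coordinates, and there
  symmetry applies. That \<open>y\<close> is the sum of its expansion relies on \<open>suppression_total\<close>.
\<close>

lemma symmetric_suppression_imp_Q_star:
  assumes S: "one_symmetric_largest_coeffs smul x xs" and U: "one_suppression_unconditional smul x xs"
  shows "property_Q_star_one smul x xs"
  unfolding property_Q_star_one_def
proof (intro allI ballI impI, elim conjE)
  fix f y A and \<epsilon> :: "nat \<Rightarrow> 'f"
  assume y: "y \<in> finite_support xs" and f: "coeff_sup_norm xs f \<le> 1" and A: "finite A"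
    and card: "card A \<le> card {n \<in> supp xs y. norm (coord n y) = 1}"
    and fy: "supp xs f \<inter> supp xs y = {}" and fyA: "supp xs (f + y) \<inter> A = {}"
    and \<epsilon>: "\<forall>n\<in>A. norm (\<epsilon> n) = 1"
  let ?y = "\<lambda>j. coord j y"
  define B where "B = {n \<in> supp xs y. norm (coord n y) = 1}"
  define R where "R = supp xs y - B"
  have fin: "finite B" "finite R" and y_fin: "finite (supp xs y)"
    using y by (auto simp: finite_support_def B_def R_def)
  have zero: "coord n f = 0" if "n \<in> supp xs y" for n
  proof -
    have "n \<notin> supp xs f" using fy that by blast
    then show ?thesis by (simp add: supp_def)
  qed
  have A0: "coord n f = 0 \<and> coord n y = 0" if "n \<in> A" for n
  proof -
    have "n \<notin> supp xs (f + y)" using fyA that by blast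
    then have "coord n f + coord n y = 0" by (simp add: supp_def)
    moreover have "coord n f = 0 \<or> coord n y = 0" using zero[of n] by (auto simp: supp_def)
    ultimately show ?thesis by auto
  qed
  have "norm (f + comb \<epsilon> A) \<le> norm (f + comb ?y B)"
  proof (rule S[unfolded one_symmetric_largest_coeffs_def, rule_format], intro conjI)
    show "A \<inter> B = {}" using A0 unfolding B_def supp_def by blast
    show "supp xs f \<inter> (A \<union> B) = {}" using A0 zero unfolding supp_def B_def by blast
    show "card A \<le> card B" using card by (simp only: B_def)
    show "\<forall>n\<in>B. norm (coord n y) = 1" by (simp add: B_def)
  qed (use f A fin(1) \<epsilon> in blast)+
  also have "\<dots> \<le> norm ((f + comb ?y B) + comb ?y R)"
    by (rule suppress_comb[OF U]) (use fin zero in \<open>simp_all add: R_def\<close>)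
  also have "\<dots> = norm (f + comb ?y (supp xs y))"
  proof -
    have "supp xs y = B \<union> R" "B \<inter> R = {}" by (auto simp: R_def B_def)
    then show ?thesis using comb_Un[OF fin, of ?y] by (simp only: add.assoc)
  qed
  also have "comb ?y (supp xs y) = y"
    using finite_support_expansion[OF U y_fin] by simp
  finally show "norm (f + comb \<epsilon> A) \<le> norm (f + y)" .
qed

text \<open>
  For a fixed \<open>A\<close> the inequality is closed in \<open>f\<close>, since the projection is continuous.
\<close>

lemma suppression_from_span:
  assumes "\<And>A g. finite A \<Longrightarrow> g \<in> span (range x) \<Longrightarrow> norm (g - comb (\<lambda>j. coord j g) A) \<le> norm g"
  shows "one_suppression_unconditional smul x xs"
  unfolding one_suppression_unconditional_def proj_conv_comb
proof (intro allI impI)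
  fix A :: "nat set" and f :: 'a
  assume A: "finite A"
  obtain g where g: "\<And>k. g k \<in> span (range x)" "g \<longlonglongrightarrow> f" using span_dense by blast
  have "(\<lambda>k. norm (g k - comb (\<lambda>j. coord j (g k)) A)) \<longlonglongrightarrow> norm (f - comb (\<lambda>j. coord j f) A)"
    by (intro tendsto_norm tendsto_diff bounded_linear.tendsto[OF bounded_linear_proj] g(2))
  then show "norm (f - comb (\<lambda>j. coord j f) A) \<le> norm f"
    by (rule LIMSEQ_le[OF _ tendsto_norm[OF g(2)]]) (use assms A g(1) in blast)
qed

text \<open>
  With \<open>A = {}\<close>, the property says that adding the disjointly supported part \<open>P\<^sub>A g\<close> to \<open>g - P\<^sub>A g\<close> does not
  decrease the norm, once \<open>g\<close> is rescaled to have coordinates of modulus at most one. The argument is confined to the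
  span, where a nonzero vector has nonempty support.
\<close>

lemma Q_star_imp_suppression:
  assumes Q: "property_Q_star_one smul x xs"
  shows "one_suppression_unconditional smul x xs"
proof (rule suppression_from_span)
  fix A :: "nat set" and g :: 'a
  assume A: "finite A" and g: "g \<in> span (range x)"
  obtain t where t: "t > 0" "\<And>n. norm (coord n g) < t" using coords_of_vector_bounded by blast
  let ?s = "of_real (1 / t) :: 'f"
  let ?Pg = "comb (\<lambda>j. coord j g) A"
  let ?f = "smul ?s (g - ?Pg)" and ?y = "smul ?s ?Pg"
  have f_span: "?f \<in> span (range x)"
    unfolding signed_indicator_def
    by (intro span_scale span_diff g span_sum) (auto intro: span_base)
  have "norm (?f + comb (\<lambda>_. 1) {}) \<le> norm (?f + ?y)"
  proof (intro Q[unfolded property_Q_star_one_def, rule_format] conjI)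
    show "?y \<in> finite_support xs"
      using A by (auto simp: finite_support_def supp_def intro: finite_subset[of _ A])
    show "coeff_sup_norm xs ?f \<le> 1"
    proof (rule coeff_sup_norm_leI)
      show "norm (coord n ?f) \<le> 1" for n
        using t(1) less_imp_le[OF t(2)[of n]] A by (simp add: norm_mult norm_divide)
    qed (rule supp_nonempty_span[OF f_span])
    show "supp xs ?f \<inter> supp xs ?y = {}" using A by (auto simp: supp_def)
  qed auto
  also have "?f + ?y = smul ?s g" by (simp add: scale_right_diff_distrib)
  finally show "norm (g - ?Pg) \<le> norm g"
    using t(1) by (simp only: comb_empty add_0_right norm_scale_of_real)
      (simp add: divide_le_cancel)
qed

lemma Q_star_imp_symmetric:
  assumes Q: "property_Q_star_one smul x xs"
  shows "one_symmetric_largest_coeffs smul x xs"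
  unfolding one_symmetric_largest_coeffs_def
proof (intro allI impI, elim conjE)
  fix f A B and \<epsilon> \<eta> :: "nat \<Rightarrow> 'f"
  assume *: "coeff_sup_norm xs f \<le> 1" "finite A" "finite B" "card A \<le> card B"
    "A \<inter> B = {}" "supp xs f \<inter> (A \<union> B) = {}"
    "\<forall>n\<in>A. norm (\<epsilon> n) = 1" "\<forall>n\<in>B. norm (\<eta> n) = 1"
  have supp: "supp xs (comb \<eta> B) = B" using *(3,8) by (auto simp: supp_def)
  have "{n \<in> supp xs (comb \<eta> B). norm (coord n (comb \<eta> B)) = 1} = B"
    unfolding supp using *(3,8) by auto
  moreover have "supp xs (f + comb \<eta> B) \<inter> A = {}"
    using *(3,5,6) by (auto simp: supp_def)
  ultimately show "norm (f + comb \<epsilon> A) \<le> norm (f + comb \<eta> B)"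
    using * supp
    by (intro Q[unfolded property_Q_star_one_def, rule_format]) (auto simp: finite_support_def)
qed

end

theorem theorem1p10:
  fixes smul :: "'f::real_normed_field \<Rightarrow> 'a::banach \<Rightarrow> 'a"
    and x :: "nat \<Rightarrow> 'a"
    and xs :: "nat \<Rightarrow> 'a \<Rightarrow>\<^sub>L 'f"
  assumes "banach_space_over smul"
    and "semi_normalized_M_basis smul x xs"
  shows "(one_greedy smul x xs \<longleftrightarrow>
            (\<forall>f. norm (f - greedy_sum smul x xs 1 f) = best_error smul x 1 f)) \<and>
         ((\<forall>f. norm (f - greedy_sum smul x xs 1 f) = best_error smul x 1 f) \<longleftrightarrow>
            one_symmetric_largest_coeffs smul x xs \<and> one_suppression_unconditional smul x xs) \<and>
         (one_symmetric_largest_coeffs smul x xs \<and> one_suppression_unconditional smul x xs \<longleftrightarrow>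
            property_Q_star_one smul x xs)"
proof -
  interpret M_basis smul x xs
    using assms by (simp add: M_basis_def M_basis_axioms_def)
  show ?thesis
    using greedy_imp_first_error first_error_imp_suppression first_error_imp_symmetric
      symmetric_suppression_imp_greedy symmetric_suppression_imp_Q_star
      Q_star_imp_suppression Q_star_imp_symmetric
    by blast
qed

end
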